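(* Let $\lambda=c_{0}$ or $\lambda=c$, let $\mu$ be an arbitrary subset of $\omega$, and let $A=(a_{nk})_{n,k\in\mathbb{N}}$ be an infinite matrix of real numbers. For $k,m,n\in\mathbb{N}$ put $$d_{nk}^{(m)}=\begin{cases}\displaystyle\sum_{j=k}^{m}\frac{f_{j+1}^{2}}{f_{k}f_{k+1}}a_{nj}, & 0\leq k\leq m,\\ 0, & k>m,\end{cases}\qquad d_{nk}=\sum_{j=k}^{\infty}\frac{f_{j+1}^{2}}{f_{k}f_{k+1}}a_{nj}.$$ Then $A\in(\lambda_{\widehat{F}},\mu)$ if and only if both of the following hold: (i) for every $n\in\mathbb{N}$, the matrix $\big(d_{nk}^{(m)}\big)_{m,k\in\mathbb{N}}$ (row index $m$, column index $k$) belongs to $(\lambda,c)$; (ii) $D=(d_{nk})_{n,k\in\mathbb{N}}$ belongs to $(\lambda,\mu)$ (this includes that the series defining the $d_{nk}$ converge, which is guaranteed by (i)).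
   Context: Let $\mathbb{N}=\{0,1,2,\dots\}$ and let $\omega$ be the vector space of all real sequences $x=(x_k)_{k\in\mathbb{N}}$. The Fibonacci numbers are defined by $f_0=f_1=1$ and $f_n=f_{n-1}+f_{n-2}$ for $n\ge 2$. For $x\in\omega$ the $\widehat{F}$-transform $\widehat{F}x=(\widehat{F}_n(x))_{n\in\mathbb{N}}$ is defined by $\widehat{F}_0(x)=x_0$ and $\widehat{F}_n(x)=\frac{f_n}{f_{n+1}}x_n-\frac{f_{n+1}}{f_n}x_{n-1}$ for $n\ge1$. Let $c_0$ and $c$ be the spaces of null and of convergent sequences; for $\lambda\in\{c_0,c\}$ put $\lambda_{\widehat{F}}=\{x\in\omega:\widehat{F}x\in\lambda\}$. For $\lambda,\mu\subseteq\omega$, $(\lambda,\mu)$ denotes the class of all infinite real matrices $A=(a_{nk})$ such that for every $x\in\lambda$ the series $A_n(x)=\sum_{k=0}^\infty a_{nk}x_k$ converges for each $n\in\mathbb{N}$ and the sequence $Ax=(A_n(x))_{n\in\mathbb{N}}$ belongs to $\mu$. *)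

theory Defs
  imports Complex_Main "HOL-Number_Theory.Fib"
begin

text \<open>The library's \<^const>\<open>fib\<close> starts with \<open>fib 0 = 0\<close>, whereas here the Fibonacci numbers
  start with \<open>f\<^sub>0 = f\<^sub>1 = 1\<close>; hence the shift.\<close>

definition fibo :: "nat \<Rightarrow> real" where
  "fibo n = real (fib (Suc n))"

lemma fibo_0: "fibo 0 = 1"
  and fibo_1: "fibo 1 = 1"
  and fibo_rec: "n \<ge> 2 \<Longrightarrow> fibo n = fibo (n - 1) + fibo (n - 2)"
proof -
  show "fibo 0 = 1" "fibo 1 = 1" by (simp_all add: fibo_def)
  assume "n \<ge> 2"
  then obtain m where "n = Suc (Suc m)"
    by (metis add_2_eq_Suc le_Suc_ex)
  then show "fibo n = fibo (n - 1) + fibo (n - 2)" by (simp add: fibo_def)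
qed

definition Fhat :: "(nat \<Rightarrow> real) \<Rightarrow> nat \<Rightarrow> real" where
  "Fhat x n = (if n = 0 then x 0
     else fibo n / fibo (n + 1) * x n - fibo (n + 1) / fibo n * x (n - 1))"

definition null_seqs :: "(nat \<Rightarrow> real) set" where
  "null_seqs = {x. x \<longlonglongrightarrow> 0}"

definition conv_seqs :: "(nat \<Rightarrow> real) set" where
  "conv_seqs = {x. convergent x}"

definition Fhat_domain :: "(nat \<Rightarrow> real) set \<Rightarrow> (nat \<Rightarrow> real) set" where
  "Fhat_domain L = {x. Fhat x \<in> L}"

definition matrix_class ::
  "(nat \<Rightarrow> real) set \<Rightarrow> (nat \<Rightarrow> real) set \<Rightarrow> (nat \<Rightarrow> nat \<Rightarrow> real) set" where
  "matrix_class L M = {A. \<forall>x\<in>L. (\<forall>n. summable (\<lambda>k. A n k * x k)) \<and>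
                                 (\<lambda>n. \<Sum>k. A n k * x k) \<in> M}"

definition d_fin :: "(nat \<Rightarrow> nat \<Rightarrow> real) \<Rightarrow> nat \<Rightarrow> nat \<Rightarrow> nat \<Rightarrow> real" where
  "d_fin A n m k =
     (if k \<le> m then \<Sum>j=k..m. (fibo (j + 1))\<^sup>2 / (fibo k * fibo (k + 1)) * A n j else 0)"

text \<open>The series over \<open>j \<ge> k\<close> is indexed by \<open>i = j - k\<close>. As \<^const>\<open>suminf\<close> is total, \<open>d_inf\<close>
  is meaningful only where \<open>d_term\<close> is summable.\<close>

definition d_term :: "(nat \<Rightarrow> nat \<Rightarrow> real) \<Rightarrow> nat \<Rightarrow> nat \<Rightarrow> nat \<Rightarrow> real" where
  "d_term A n k i = (fibo (k + i + 1))\<^sup>2 / (fibo k * fibo (k + 1)) * A n (k + i)"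

definition d_inf :: "(nat \<Rightarrow> nat \<Rightarrow> real) \<Rightarrow> nat \<Rightarrow> nat \<Rightarrow> real" where
  "d_inf A n k = (\<Sum>i. d_term A n k i)"

end

theory Submission
  imports Defs
begin

text \<open>
  The transform \<open>Fhat\<close> is a bijection of the space of all sequences: division by
  \<open>f\<^sub>n f\<^sub>n\<^sub>+\<^sub>1\<close> turns it into taking differences of \<open>x\<^sub>n / f\<^sub>n\<^sub>+\<^sub>1\<^sup>2\<close>, so it is inverted by
  summation (\<open>Fhat_inverse\<close>). Hence \<open>x\<close> runs through the \<open>Fhat\<close>-domain of \<open>L\<close> exactly when
  \<open>x = Fhat_inverse y\<close> with \<open>y \<in> L\<close>, and with \<open>b\<^sub>j = f\<^sub>j\<^sub>+\<^sub>1\<^sup>2 a\<^sub>n\<^sub>j\<close> and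
  \<open>g\<^sub>k = y\<^sub>k / (f\<^sub>k f\<^sub>k\<^sub>+\<^sub>1)\<close> the series \<open>A\<^sub>n(x)\<close> becomes \<open>\<Sum>\<^sub>k b\<^sub>k (g\<^sub>0 + \<dots> + g\<^sub>k)\<close>.
  Its partial sums, reordered, are the rows of the triangle \<open>d_fin\<close> applied to \<open>y\<close>
  (\<open>sums_d_fin_row\<close>).

  The interchange of limits that turns these rows into the row of \<open>d_inf\<close> is where the
  Fibonacci numbers matter. They grow geometrically, so \<open>\<Sum>\<^sub>k 1 / (f\<^sub>k f\<^sub>k\<^sub>+\<^sub>1)\<close> converges, and
  \<open>\<Sum>\<^sub>k g\<^sub>k\<close> converges absolutely for each bounded \<open>y\<close>. Summation by parts
  (\<open>sums_summation_by_parts\<close>) then gives \<open>A\<^sub>n(x) = \<Sum>\<^sub>k d\<^sub>n\<^sub>k y\<^sub>k\<close>, provided only that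
  \<open>\<Sum>\<^sub>j b\<^sub>j\<close> converges: the boundary term is a tail of \<open>b\<close> times a partial sum of \<open>g\<close>. Thus
  \<open>c\<^sub>0\<close> and \<open>c\<close> enter in the same way, as sets of bounded sequences.

  Convergence of \<open>\<Sum>\<^sub>j b\<^sub>j\<close>, finally, is implied by either side of the equivalence: it is
  convergence of \<open>A\<^sub>n(x)\<close> for the \<open>x\<close> belonging to the unit sequence \<open>y = (1, 0, 0, \<dots>)\<close>, and
  it is also convergence of the series \<open>d\<^sub>n\<^sub>0\<close>.
\<close>

section \<open>Summation by parts against the tails of a series\<close>

lemma sum_by_tails:
  fixes b g :: "nat \<Rightarrow> real"
  assumes "summable b"
  shows "(\<Sum>k\<le>m. b k * (\<Sum>j\<le>k. g j)) =
    (\<Sum>k\<le>m. g k * (\<Sum>i. b (k + i))) - (\<Sum>i. b (Suc m + i)) * (\<Sum>j\<le>m. g j)"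
proof -
  have tail: "(\<Sum>i. b (k + i)) = b k + (\<Sum>i. b (Suc k + i))" for k
  proof -
    have "summable (\<lambda>i. b (k + i))"
      using assms by (simp add: summable_iff_shift[of b k] add.commute[of k])
    then show ?thesis
      using suminf_split_head[of "\<lambda>i. b (k + i)"] by simp
  qed
  show ?thesis
  proof (induction m)
    case 0
    show ?case using tail[of 0] by (simp add: algebra_simps)
  next
    case (Suc m)
    then show ?case using tail[of "Suc m"] by (simp add: algebra_simps)
  qed
qed

text \<open>The tails of \<open>b\<close> tend to zero. Being bounded, they preserve the absolute convergence of
  \<open>\<Sum>g\<close>; being null, they make the boundary term vanish in the limit.\<close>

lemma sums_summation_by_parts:
  fixes b g :: "nat \<Rightarrow> real"
  assumes b: "summable b" and g: "summable (\<lambda>k. \<bar>g k\<bar>)"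
  shows "summable (\<lambda>k. g k * (\<Sum>i. b (k + i)))"
    and "(\<lambda>k. b k * (\<Sum>j\<le>k. g j)) sums (\<Sum>k. g k * (\<Sum>i. b (k + i)))"
proof -
  define R where "R k = (\<Sum>i. b (k + i))" for k
  have R_lim: "R \<longlonglongrightarrow> 0"
    using suminf_exist_split[OF _ b] by (intro LIMSEQ_I) (simp add: R_def add.commute)
  then have "Bseq R"
    by (simp add: convergentI convergent_imp_Bseq)
  then obtain K where K: "\<And>k. \<bar>R k\<bar> \<le> K"
    by (auto simp: Bseq_def)
  show sR: "summable (\<lambda>k. g k * (\<Sum>i. b (k + i)))"
    unfolding R_def[symmetric]
  proof (rule summable_comparison_test')
    show "summable (\<lambda>k. \<bar>g k\<bar> * K)"
      using g by (rule summable_mult2)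
    show "norm (g k * R k) \<le> \<bar>g k\<bar> * K" for k
      using K by (simp add: abs_mult mult_left_mono)
  qed
  have "(\<lambda>m. (\<Sum>k\<le>m. g k * R k) - R (Suc m) * (\<Sum>j\<le>m. g j))
      \<longlonglongrightarrow> (\<Sum>k. g k * R k) - 0 * (\<Sum>j. g j)"
    using sR g R_lim
    by (intro tendsto_intros summable_LIMSEQ' LIMSEQ_Suc)
       (auto simp flip: R_def intro: summable_rabs_cancel)
  then show "(\<lambda>k. b k * (\<Sum>j\<le>k. g j)) sums (\<Sum>k. g k * (\<Sum>i. b (k + i)))"
    by (simp add: sums_def_le sum_by_tails[OF b] R_def)
qed

lemma sum_triangle_swap:
  fixes b g :: "nat \<Rightarrow> real"
  shows "(\<Sum>k\<le>m. b k * (\<Sum>j\<le>k. g j)) = (\<Sum>k\<le>m. g k * (\<Sum>j=k..m. b j))"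
proof (induction m)
  case (Suc m)
  have "(\<Sum>k\<le>m. g k * (\<Sum>j=k..Suc m. b j)) =
      (\<Sum>k\<le>m. g k * (\<Sum>j=k..m. b j)) + b (Suc m) * (\<Sum>k\<le>m. g k)"
    by (simp add: sum.distrib sum_distrib_left algebra_simps)
  with Suc show ?case by (simp add: algebra_simps)
qed simp

section \<open>Reciprocals of products of consecutive Fibonacci numbers\<close>

lemma fibo_pos: "fibo n > 0"
  by (simp add: fibo_def fib_neq_0_nat)

text \<open>Since \<open>f\<^sub>k\<^sub>+\<^sub>2 \<ge> 2 f\<^sub>k\<close>, the ratio \<open>f\<^sub>k / f\<^sub>k\<^sub>+\<^sub>2\<close> of consecutive terms is at most one half.\<close>

lemma summable_inverse_fibo_products: "summable (\<lambda>k. 1 / (fibo k * fibo (k + 1)))"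
proof (rule summable_ratio_test[where c = "1/2" and N = 0])
  fix k
  have "2 * fibo k \<le> fibo (Suc (Suc k))"
    using fib_mono[of "Suc k" "Suc (Suc k)"] by (simp add: fibo_def)
  then show "norm (1 / (fibo (Suc k) * fibo (Suc k + 1)))
      \<le> 1/2 * norm (1 / (fibo k * fibo (k + 1)))"
    using fibo_pos[of k] fibo_pos[of "Suc k"] fibo_pos[of "Suc (Suc k)"]
    by (simp add: abs_mult divide_simps)
qed simp

lemma summable_bounded_over_fibo_products:
  assumes "Bseq y"
  shows "summable (\<lambda>k. \<bar>y k / (fibo k * fibo (k + 1))\<bar>)"
proof -
  from assms obtain K where K: "\<And>k. \<bar>y k\<bar> \<le> K"
    by (auto simp: Bseq_def)
  show ?thesis
  proof (rule summable_comparison_test')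
    show "summable (\<lambda>k. K * (1 / (fibo k * fibo (k + 1))))"
      using summable_inverse_fibo_products by (rule summable_mult)
    show "norm \<bar>y k / (fibo k * fibo (k + 1))\<bar> \<le> K * (1 / (fibo k * fibo (k + 1)))" for k
      using K[of k] fibo_pos[of k] fibo_pos[of "k + 1"]
      by (simp add: abs_mult divide_right_mono)
  qed
qed

section \<open>The inverse of the transform\<close>

definition Fhat_inverse :: "(nat \<Rightarrow> real) \<Rightarrow> nat \<Rightarrow> real" where
  "Fhat_inverse y k = (fibo (k + 1))\<^sup>2 * (\<Sum>j\<le>k. y j / (fibo j * fibo (j + 1)))"

lemma Fhat_Fhat_inverse: "Fhat (Fhat_inverse y) = y"
proof
  fix n
  show "Fhat (Fhat_inverse y) n = y n"
  proof (cases n)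
    case 0
    then show ?thesis by (simp add: Fhat_def Fhat_inverse_def fibo_def)
  next
    case (Suc m)
    then show ?thesis
      using fibo_pos[of "Suc m"] fibo_pos[of "Suc (Suc m)"]
      by (simp add: Fhat_def Fhat_inverse_def field_simps power2_eq_square)
  qed
qed

lemma Fhat_inverse_Fhat: "Fhat_inverse (Fhat x) = x"
proof
  fix n
  have "(\<Sum>j\<le>n. Fhat x j / (fibo j * fibo (j + 1))) = x n / (fibo (n + 1))\<^sup>2"
  proof (induction n)
    case 0
    show ?case by (simp add: Fhat_def fibo_def)
  next
    case (Suc m)
    then show ?case
      using fibo_pos[of "Suc m"] fibo_pos[of "Suc (Suc m)"]
      by (simp add: Fhat_def field_simps power2_eq_square)
  qed
  then show "Fhat_inverse (Fhat x) n = x n"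
    using fibo_pos[of "n + 1"] by (simp add: Fhat_inverse_def)
qed

lemma Fhat_domain_eq_image: "Fhat_domain L = Fhat_inverse ` L"
proof
  show "Fhat_domain L \<subseteq> Fhat_inverse ` L"
    by (metis Fhat_domain_def Fhat_inverse_Fhat image_eqI mem_Collect_eq subsetI)
  show "Fhat_inverse ` L \<subseteq> Fhat_domain L"
    by (auto simp: Fhat_domain_def Fhat_Fhat_inverse)
qed

section \<open>The transformed rows\<close>

text \<open>Up to the column factor \<open>1 / (f\<^sub>k f\<^sub>k\<^sub>+\<^sub>1)\<close>, column \<open>k\<close> of \<open>d_inf\<close> is a tail of the same
  series for every \<open>k\<close>, so all columns converge or diverge together with column \<open>0\<close>.\<close>

lemma summable_d_term_iff:
  "summable (d_term A n k) \<longleftrightarrow> summable (\<lambda>j. (fibo (j + 1))\<^sup>2 * A n j)"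
proof -
  have "d_term A n k = (\<lambda>i. 1 / (fibo k * fibo (k + 1)) *
      ((fibo (i + k + 1))\<^sup>2 * A n (i + k)))"
    by (rule ext) (simp add: d_term_def add.commute[of k])
  moreover have "1 / (fibo k * fibo (k + 1)) \<noteq> 0"
    using fibo_pos[of k] fibo_pos[of "k + 1"] by simp
  ultimately show ?thesis
    using summable_iff_shift[of "\<lambda>j. (fibo (j + 1))\<^sup>2 * A n j" k]
    by (simp only: summable_cmult_iff) simp
qed

lemma d_inf_eq:
  assumes "summable (\<lambda>j. (fibo (j + 1))\<^sup>2 * A n j)"
  shows "d_inf A n k =
    1 / (fibo k * fibo (k + 1)) * (\<Sum>i. (fibo (k + i + 1))\<^sup>2 * A n (k + i))"
proof -
  have "summable (\<lambda>i. (fibo (k + i + 1))\<^sup>2 * A n (k + i))"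
    using assms summable_iff_shift[of "\<lambda>j. (fibo (j + 1))\<^sup>2 * A n j" k]
    by (simp add: add.commute[of k])
  from suminf_mult[OF this, of "1 / (fibo k * fibo (k + 1))"] show ?thesis
    by (simp add: d_inf_def d_term_def[abs_def])
qed

lemma A_times_Fhat_inverse:
  "A n k * Fhat_inverse y k =
    (fibo (k + 1))\<^sup>2 * A n k * (\<Sum>j\<le>k. y j / (fibo j * fibo (j + 1)))"
  by (simp add: Fhat_inverse_def)

lemma sums_d_fin_row:
  "(\<lambda>k. d_fin A n m k * y k) sums (\<Sum>k\<le>m. A n k * Fhat_inverse y k)"
proof -
  have "(\<Sum>k\<le>m. A n k * Fhat_inverse y k) =
      (\<Sum>k\<le>m. y k / (fibo k * fibo (k + 1)) * (\<Sum>j=k..m. (fibo (j + 1))\<^sup>2 * A n j))"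
    unfolding A_times_Fhat_inverse by (rule sum_triangle_swap)
  also have "\<dots> = (\<Sum>k\<le>m. d_fin A n m k * y k)"
    by (rule sum.cong) (auto simp: d_fin_def sum_distrib_left sum_distrib_right
        intro!: sum.cong)
  finally show ?thesis
    using sums_finite[of "{..m}" "\<lambda>k. d_fin A n m k * y k"] by (simp add: d_fin_def)
qed

text \<open>The boundedness of \<open>y\<close> is what makes \<open>\<Sum>\<^sub>k y\<^sub>k / (f\<^sub>k f\<^sub>k\<^sub>+\<^sub>1)\<close> absolutely convergent, as
  summation by parts demands.\<close>

lemma row_transfer:
  assumes b: "summable (\<lambda>j. (fibo (j + 1))\<^sup>2 * A n j)" and y: "Bseq y"
  shows "summable (\<lambda>k. d_inf A n k * y k)"
    and "(\<lambda>k. A n k * Fhat_inverse y k) sums (\<Sum>k. d_inf A n k * y k)"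
proof -
  have eq: "d_inf A n k * y k = y k / (fibo k * fibo (k + 1)) *
      (\<Sum>i. (fibo (k + i + 1))\<^sup>2 * A n (k + i))" for k
    by (simp add: d_inf_eq[of A n, OF b])
  note parts = sums_summation_by_parts[OF b summable_bounded_over_fibo_products[OF y]]
  show "summable (\<lambda>k. d_inf A n k * y k)"
    unfolding eq by (rule parts(1))
  show "(\<lambda>k. A n k * Fhat_inverse y k) sums (\<Sum>k. d_inf A n k * y k)"
    unfolding eq A_times_Fhat_inverse by (rule parts(2))
qed

section \<open>Characterization of the matrix class\<close>

lemma d_fin_matrix_class:
  assumes b: "summable (\<lambda>j. (fibo (j + 1))\<^sup>2 * A n j)" and L: "\<And>y. y \<in> L \<Longrightarrow> Bseq y"
  shows "(\<lambda>m k. d_fin A n m k) \<in> matrix_class L conv_seqs"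
proof -
  have "convergent (\<lambda>m. \<Sum>k\<le>m. A n k * Fhat_inverse y k)" if "y \<in> L" for y
    using row_transfer(2)[of A n y, OF b L[OF that]] by (auto simp: sums_def_le convergent_def)
  then show ?thesis
    using sums_d_fin_row[of A n]
    by (auto simp: matrix_class_def conv_seqs_def sums_iff)
qed

lemma matrix_class_Fhat_domain_iff:
  assumes b: "\<And>n. summable (\<lambda>j. (fibo (j + 1))\<^sup>2 * A n j)" and L: "\<And>y. y \<in> L \<Longrightarrow> Bseq y"
  shows "A \<in> matrix_class (Fhat_domain L) M \<longleftrightarrow> (\<lambda>n k. d_inf A n k) \<in> matrix_class L M"
proof -
  have "summable (\<lambda>k. A n k * Fhat_inverse y k)"
    "(\<Sum>k. A n k * Fhat_inverse y k) = (\<Sum>k. d_inf A n k * y k)"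
    "summable (\<lambda>k. d_inf A n k * y k)" if "y \<in> L" for n y
    using row_transfer[of A n y, OF b L[OF that]] by (simp_all add: sums_iff)
  then show ?thesis
    by (simp add: matrix_class_def Fhat_domain_eq_image)
qed

text \<open>The unit sequence at \<open>0\<close> is the transform of \<open>(f\<^sub>k\<^sub>+\<^sub>1\<^sup>2)\<^sub>k\<close>.\<close>

lemma summable_of_matrix_class:
  assumes A: "A \<in> matrix_class (Fhat_domain L) M"
    and e0: "(\<lambda>k. if k = 0 then 1 else 0) \<in> L"
  shows "summable (\<lambda>j. (fibo (j + 1))\<^sup>2 * A n j)"
proof -
  let ?e = "\<lambda>k::nat. if k = 0 then 1 else 0 :: real"
  have "(\<Sum>j\<le>k. ?e j / (fibo j * fibo (j + 1))) = 1" for k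
    by (induction k) (simp_all add: fibo_def)
  then have "A n k * Fhat_inverse ?e k = (fibo (k + 1))\<^sup>2 * A n k" for k
    by (simp add: Fhat_inverse_def)
  moreover have "summable (\<lambda>k. A n k * Fhat_inverse ?e k)"
    using A e0 unfolding matrix_class_def Fhat_domain_eq_image by blast
  ultimately show ?thesis by (simp only:)
qed

theorem theorem4p4:
  fixes L M :: "(nat \<Rightarrow> real) set" and A :: "nat \<Rightarrow> nat \<Rightarrow> real"
  assumes "L = null_seqs \<or> L = conv_seqs"
  shows "A \<in> matrix_class (Fhat_domain L) M \<longleftrightarrow>
    (\<forall>n. (\<lambda>m k. d_fin A n m k) \<in> matrix_class L conv_seqs) \<and>
    ((\<forall>n k. summable (d_term A n k)) \<and> (\<lambda>n k. d_inf A n k) \<in> matrix_class L M)"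
proof -
  have bounded: "Bseq y" if "y \<in> L" for y
    using assms that
    by (auto simp: null_seqs_def conv_seqs_def intro: convergentI convergent_imp_Bseq)
  have "(\<lambda>k. if k = 0 then 1 else 0 :: real) \<longlonglongrightarrow> 0"
    by (rule tendsto_eventually) (auto simp: eventually_sequentially intro: exI[of _ 1])
  then have e0: "(\<lambda>k. if k = 0 then 1 else 0) \<in> L"
    using assms by (auto simp: null_seqs_def conv_seqs_def intro: convergentI)
  show ?thesis
  proof (cases "\<forall>n. summable (\<lambda>j. (fibo (j + 1))\<^sup>2 * A n j)")
    case True
    then show ?thesis
      using matrix_class_Fhat_domain_iff[of A L M] d_fin_matrix_class[of A _ L] bounded
      by (simp add: summable_d_term_iff)
  next
    case False
    then show ?thesis
      using summable_of_matrix_class[OF _ e0] by (auto simp: summable_d_term_iff)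
  qed
qed

end
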